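(* Let $a,b,c\ge 0$ be real numbers, and let $[\mathcal{B}_{n,k}]_{n,k\ge 0}$ be the triangular array satisfying $$\mathcal{B}_{n,k}=a\,\mathcal{B}_{n-1,k-1}+2b(n-1)\mathcal{B}_{n-2,k-1}+3c(n-1)(n-2)\mathcal{B}_{n-3,k-1}\qquad (n,k\ge 1),$$ where $\mathcal{B}_{0,k}=\delta_{0,k}$ for $k\ge 0$, $\mathcal{B}_{n,0}=0$ for $n\ge 1$, and $\mathcal{B}_{n,k}=0$ for $n<0$. Then: (i) for $n,k\ge 1$, $$\mathcal{B}_{n,k}=\frac{n!}{k!}\sum_{i=0}^ka^{k-i}c^{n-k-i}b^{2i-n+k}\binom{k}{i}\binom{i}{n-k-i};$$ (ii) for every integer $r\ge 1$, the lower-triangular matrix $[\mathcal{B}_{n,k}]_{n,k\ge 0}$ is TP$_r$ if $b^2\ge 4ac\cos^2\frac{\pi}{r+1}$; (iii) the lower-triangular matrix $[\mathcal{B}_{n,k}]_{n,k\ge 0}$ is TP if $b^2\ge 4ac$.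
   Context: A real matrix is TP$_r$ if all its minors of order at most $r$ are nonnegative, and TP if all its minors are nonnegative. In the formula, $\binom{i}{j}=0$ for $j<0$ or $j>i$, terms with a vanishing binomial coefficient are read as $0$, and $0^0=1$. *)

theory Defs
  imports Complex_Main "Jordan_Normal_Form.Determinant"
begin

text \<open>
  Infinite real matrices are functions \<^typ>\<open>nat \<Rightarrow> nat \<Rightarrow> real\<close>. Selecting the rows
  \<open>I 0 < \<dots> < I (m - 1)\<close> and the columns \<open>J 0 < \<dots> < J (m - 1)\<close> gives a minor of order \<open>m\<close>;
  the values of \<open>I\<close> and \<open>J\<close> at arguments \<open>\<ge> m\<close> are irrelevant.
\<close>

definition minor :: "(nat \<Rightarrow> nat \<Rightarrow> real) \<Rightarrow> nat \<Rightarrow> (nat \<Rightarrow> nat) \<Rightarrow> (nat \<Rightarrow> nat) \<Rightarrow> real" where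
  "minor M m I J = det (mat m m (\<lambda>(i, j). M (I i) (J j)))"

definition TP_upto :: "nat \<Rightarrow> (nat \<Rightarrow> nat \<Rightarrow> real) \<Rightarrow> bool" where
  "TP_upto r M \<longleftrightarrow>
     (\<forall>m I J. 1 \<le> m \<and> m \<le> r \<and> strict_mono_on {..<m} I \<and> strict_mono_on {..<m} J
        \<longrightarrow> 0 \<le> minor M m I J)"

definition TP :: "(nat \<Rightarrow> nat \<Rightarrow> real) \<Rightarrow> bool" where
  "TP M \<longleftrightarrow>
     (\<forall>m I J. 1 \<le> m \<and> strict_mono_on {..<m} I \<and> strict_mono_on {..<m} J
        \<longrightarrow> 0 \<le> minor M m I J)"

text \<open>Binomial coefficient whose lower index may be negative, in which case it vanishes.\<close>

definition binomial_int :: "nat \<Rightarrow> int \<Rightarrow> nat" where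
  "binomial_int i j = (if j < 0 then 0 else i choose nat j)"

end

theory Submission
  imports Defs
begin

text \<open>
  The array is the exponential Riordan array of \<open>f = a t + b t\<^sup>2 + c t\<^sup>3\<close>: the entry in row \<open>n\<close>
  and column \<open>k\<close> is \<open>n! / k!\<close> times the coefficient of \<open>t\<^sup>n\<close> in \<open>f\<^sup>k\<close>, because the
  recurrence is what \<open>(f\<^sup>k)' = k f\<^sup>k\<^sup>-\<^sup>1 f'\<close> says about coefficients. The explicit formula comes
  from expanding \<open>f\<^sup>k = t\<^sup>k (a + t (b + c t))\<^sup>k\<close> twice by the binomial theorem.

  Positive factors attached to rows and columns do not change the sign of a minor, so total
  positivity concerns the matrix \<open>R\<close> of coefficients of \<open>t\<^sup>n\<close> in \<open>f\<^sup>k = (t g)\<^sup>k\<close>, where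
  \<open>g = a + b t + c t\<^sup>2\<close>. Writing \<open>f\<^sup>k\<^sup>+\<^sup>1 = t \<sqdot> g \<sqdot> f\<^sup>k\<close> shows that \<open>R\<close> without its first row and
  column is \<open>T R\<close>, where \<open>T\<close> is the lower triangular Toeplitz matrix of \<open>g\<close>. Since \<open>T\<close> is lower
  triangular, the first \<open>N + 1\<close> rows of \<open>R\<close> are determined by the first \<open>N\<close> rows, and the
  Cauchy-Binet formula transfers nonnegativity of the minors from \<open>T\<close> to \<open>R\<close> by induction on
  \<open>N\<close> (\<open>TP_upto_riordan\<close>).

  It remains to treat \<open>T\<close> (\<open>TP_upto_toeplitz_quadratic\<close>). Its three nonzero diagonals make it a
  tridiagonal matrix once the row index is shifted by one. A minor of such a matrix factors into
  single entries and contiguous principal minors, the continuants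
  \<open>D\<^sub>m\<^sub>+\<^sub>2 = b D\<^sub>m\<^sub>+\<^sub>1 - a c D\<^sub>m\<close>. If \<open>b = 2 \<surd>(a c) cos \<theta>\<close>, then \<open>D\<^sub>m\<close> is
  \<open>(a c)\<^sup>m\<^sup>/\<^sup>2 sin ((m + 1) \<theta>) / sin \<theta>\<close>, which is nonnegative up to \<open>m = r\<close> for
  \<open>\<theta> = \<pi> / (r + 1)\<close>; for larger \<open>b\<close> the ratios \<open>D\<^sub>m\<^sub>+\<^sub>1 / D\<^sub>m\<close> are at least as large
  (\<open>continuant_nonneg\<close>).
\<close>

section \<open>Elementary properties of minors\<close>

lemma minor_cong:
  assumes "\<And>i j. i < m \<Longrightarrow> j < m \<Longrightarrow> M (I i) (J j) = M' (I' i) (J' j)"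
  shows "minor M m I J = minor M' m I' J'"
  unfolding minor_def by (intro arg_cong[where f = det] cong_mat) (auto simp: assms)

lemma minor_0 [simp]: "minor M 0 I J = 1"
  by (simp add: minor_def)

lemma minor_1 [simp]: "minor M (Suc 0) I J = M (I 0) (J 0)"
  by (simp add: minor_def det_single)

lemma minor_transpose: "minor (\<lambda>i j. M j i) m J I = minor M m I J"
proof -
  have "mat m m (\<lambda>(i, j). M (I j) (J i)) = (mat m m (\<lambda>(i, j). M (I i) (J j)))\<^sup>T"
    by (rule eq_matI) auto
  then show ?thesis
    unfolding minor_def by (simp add: det_transpose[where n = m])
qed

lemma minor_leibniz:
  "minor M m I J = (\<Sum>p | p permutes {0..<m}. signof p * (\<Prod>i = 0..<m. M (I i) (J (p i))))"
  unfolding minor_def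
  by (subst det_def'[where n = m]) (auto intro!: sum.cong prod.cong dest: permutes_in_image)

lemma minor_leibniz':
  "minor M m I J = (\<Sum>p | p permutes {0..<m}. signof p * (\<Prod>i = 0..<m. M (I (p i)) (J i)))"
  by (subst minor_transpose[symmetric]) (rule minor_leibniz)

lemma minor_permute_rows:
  assumes "p permutes {0..<m}"
  shows "minor M m (\<lambda>i. I (p i)) J = signof p * minor M m I J"
proof -
  have permuted: "mat m m (\<lambda>(i, j). M (I (p i)) (J j))
      = mat m m (\<lambda>(i, j). mat m m (\<lambda>(i, j). M (I i) (J j)) $$ (p i, j))"
    using assms by (intro eq_matI) (auto dest: permutes_in_image)
  show ?thesis
    unfolding minor_def by (subst permuted) (rule det_permute_rows[OF mat_carrier assms])
qed

lemma minor_equal_rows: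
  assumes "i < m" "i' < m" "i \<noteq> i'" "I i = I i'"
  shows "minor M m I J = 0"
  unfolding minor_def
  by (rule det_identical_rows[where n = m and i = i and j = i']) (use assms in auto)

lemma minor_scale:
  "minor (\<lambda>i j. u i * v j * M i j) m I J
     = (\<Prod>i<m. u (I i)) * (\<Prod>j<m. v (J j)) * minor M m I J"
proof -
  have "(\<Prod>i = 0..<m. u (I i) * v (J (p i)) * M (I i) (J (p i)))
      = (\<Prod>i<m. u (I i)) * (\<Prod>j<m. v (J j)) * (\<Prod>i = 0..<m. M (I i) (J (p i)))"
    if "p permutes {0..<m}" for p
    using prod.permute[OF that, of "\<lambda>j. v (J j)"]
    by (simp add: prod.distrib o_def lessThan_atLeast0)
  then show ?thesis
    unfolding minor_leibniz sum_distrib_left by (intro sum.cong) (auto simp: mult_ac)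
qed

text \<open>
  The next two lemmas are the block triangular case of the determinant, which is what makes minors
  of sparse matrices factor.
\<close>

lemma minor_block_lower:
  assumes "l \<le> m" and zero: "\<And>i j. i < l \<Longrightarrow> l \<le> j \<Longrightarrow> j < m \<Longrightarrow> M (I i) (J j) = 0"
  shows "minor M m I J = minor M l I J * minor M (m - l) (\<lambda>i. I (i + l)) (\<lambda>j. J (j + l))"
proof -
  let ?A = "mat l l (\<lambda>(i, j). M (I i) (J j))"
  let ?C = "mat (m - l) l (\<lambda>(i, j). M (I (i + l)) (J j))"
  let ?D = "mat (m - l) (m - l) (\<lambda>(i, j). M (I (i + l)) (J (j + l)))"
  have "mat m m (\<lambda>(i, j). M (I i) (J j)) = four_block_mat ?A (0\<^sub>m l (m - l)) ?C ?D"
    using assms by (intro eq_matI) (auto simp: zero)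
  moreover have "det \<dots> = det ?A * det ?D"
    by (rule det_four_block_mat_upper_right_zero[where n = l and m = "m - l"]) auto
  ultimately show ?thesis
    unfolding minor_def by simp
qed

lemma minor_block_upper:
  assumes "l \<le> m" and "\<And>i j. l \<le> i \<Longrightarrow> i < m \<Longrightarrow> j < l \<Longrightarrow> M (I i) (J j) = 0"
  shows "minor M m I J = minor M l I J * minor M (m - l) (\<lambda>i. I (i + l)) (\<lambda>j. J (j + l))"
  using minor_block_lower[of l m "\<lambda>i j. M j i" J I] assms
  by (simp add: minor_transpose[of M])

lemma minor_split_nonneg:
  assumes "l \<le> m"
    and "(\<forall>i j. i < l \<longrightarrow> l \<le> j \<longrightarrow> j < m \<longrightarrow> M (I i) (J j) = 0)
       \<or> (\<forall>i j. l \<le> i \<longrightarrow> i < m \<longrightarrow> j < l \<longrightarrow> M (I i) (J j) = 0)"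
    and "0 \<le> minor M l I J" "0 \<le> minor M (m - l) (\<lambda>i. I (i + l)) (\<lambda>j. J (j + l))"
  shows "0 \<le> minor M m I J"
  using minor_block_lower[of l m M I J] minor_block_upper[of l m M I J] assms by auto

lemma minor_first_row:
  "minor M (Suc m) I J = (\<Sum>j<Suc m. (-1) ^ j * M (I 0) (J j) *
      minor M m (\<lambda>i. I (Suc i)) (\<lambda>k. J (if k < j then k else Suc k)))"
proof -
  let ?A = "mat (Suc m) (Suc m) (\<lambda>(i, j). M (I i) (J j))"
  have "mat_delete ?A 0 j = mat m m (\<lambda>(i, k). M (I (Suc i)) (J (if k < j then k else Suc k)))"
    if "j < Suc m" for j
    unfolding mat_delete_def by (rule eq_matI) auto
  then show ?thesis
    unfolding minor_def
    by (subst laplace_expansion_row[where n = "Suc m" and i = 0])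
       (auto simp: cofactor_def intro!: sum.cong)
qed

section \<open>The Cauchy-Binet formula and products\<close>

text \<open>
  The Cauchy-Binet formula, with the sum over subsets replaced by a sum over all functions: each
  subset is counted once for each of its \<open>m!\<close> enumerations, and functions that are not injective
  contribute 0. In this form no choice of representatives is needed: expanding both minors by the
  Leibniz formula and summing over \<open>f\<close> first produces the entries of the product.
\<close>

lemma cauchy_binet_functions:
  fixes M A B :: "nat \<Rightarrow> nat \<Rightarrow> real"
  assumes "\<And>i j. i < m \<Longrightarrow> j < m \<Longrightarrow> M (I i) (J j) = (\<Sum>l = 0..<N. A (I' i) l * B l (J' j))"
  shows "fact m * minor M m I J
    = (\<Sum>f \<in> {0..<m} \<rightarrow>\<^sub>E {0..<N}. minor A m I' f * minor B m f J')"
proof -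
  let ?S = "{p. p permutes {0..<m}}"
  have prod_entry: "(\<Sum>f \<in> {0..<m} \<rightarrow>\<^sub>E {0..<N}. \<Prod>i = 0..<m. A (I' (p i)) (f i) * B (f i) (J' (q i)))
      = (\<Prod>i = 0..<m. M (I (p i)) (J (q i)))" if "p \<in> ?S" "q \<in> ?S" for p q
  proof -
    have "p i < m" "q i < m" if "i < m" for i
      using \<open>p \<in> ?S\<close> \<open>q \<in> ?S\<close> permutes_in_image[of p "{0..<m}" i] permutes_in_image[of q "{0..<m}" i] that
      by auto
    then show ?thesis
      by (simp add: assms prod_sum_PiE)
  qed
  have "(\<Sum>f \<in> {0..<m} \<rightarrow>\<^sub>E {0..<N}. minor A m I' f * minor B m f J')
      = (\<Sum>f \<in> {0..<m} \<rightarrow>\<^sub>E {0..<N}. \<Sum>p\<in>?S. \<Sum>q\<in>?S. signof p * (signof q *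
          (\<Prod>i = 0..<m. A (I' (p i)) (f i) * B (f i) (J' (q i)))))"
    by (simp add: minor_leibniz'[of A] minor_leibniz[of B] sum_product prod.distrib mult_ac)
  also have "\<dots> = (\<Sum>p\<in>?S. \<Sum>q\<in>?S. signof p * (signof q *
      (\<Sum>f \<in> {0..<m} \<rightarrow>\<^sub>E {0..<N}. \<Prod>i = 0..<m. A (I' (p i)) (f i) * B (f i) (J' (q i)))))"
    unfolding sum_distrib_left
    by (subst sum.swap, rule sum.cong[OF refl], rule sum.swap)
  also have "\<dots> = (\<Sum>p\<in>?S. signof p * minor M m (\<lambda>i. I (p i)) J)"
    by (intro sum.cong refl) (simp add: prod_entry minor_leibniz sum_distrib_left)
  also have "\<dots> = (\<Sum>p\<in>?S. minor M m I J)"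
    by (intro sum.cong refl) (auto simp: minor_permute_rows sign_def)
  also have "\<dots> = fact m * minor M m I J"
    by (simp add: card_permutations[where n = m])
  finally show ?thesis ..
qed

lemma strict_mono_on_lessThan_shift:
  fixes I :: "nat \<Rightarrow> nat"
  assumes "strict_mono_on {..<m} I"
  shows "strict_mono_on {..<m - l} (\<lambda>i. I (i + l))"
  using assms by (simp add: strict_mono_on_def less_diff_conv)

lemma strict_mono_on_lessThan_prefix:
  fixes I :: "nat \<Rightarrow> nat"
  assumes "strict_mono_on {..<m} I" "l \<le> m"
  shows "strict_mono_on {..<l} I"
  using assms by (auto simp: strict_mono_on_def)

lemma sorting_permutation:
  fixes f :: "nat \<Rightarrow> nat"
  assumes "inj_on f {0..<m}"
  obtains s p where "strict_mono_on {..<m} s" "s ` {..<m} = f ` {0..<m}" "p permutes {0..<m}"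
    "\<And>i. i < m \<Longrightarrow> f i = s (p i)"
proof -
  obtain s where s: "bij_betw s {..<m} (f ` {0..<m})" and mono: "strict_mono_on {..<m} s"
    using ex_bij_betw_strict_mono_card[of "f ` {0..<m}"] assms by (auto simp: card_image)
  have s: "bij_betw s {0..<m} (f ` {0..<m})"
    using s by (simp add: lessThan_atLeast0)
  define p where "p i = (if i < m then inv_into {0..<m} s (f i) else i)" for i
  have "bij_betw (inv_into {0..<m} s \<circ> f) {0..<m} {0..<m}"
    by (rule bij_betw_trans[OF inj_on_imp_bij_betw[OF assms] bij_betw_inv_into[OF s]])
  then have "bij_betw p {0..<m} {0..<m}"
    by (rule bij_betw_cong[THEN iffD1, rotated]) (simp add: p_def)
  then have "p permutes {0..<m}"
    by (rule bij_imp_permutes) (simp add: p_def)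
  moreover have "f i = s (p i)" if "i < m" for i
    using that s by (auto simp: p_def bij_betw_def f_inv_into_f)
  moreover have "s ` {..<m} = f ` {0..<m}"
    using s by (simp add: bij_betw_def lessThan_atLeast0)
  ultimately show thesis
    using that mono by blast
qed

text \<open>
  Sorting \<open>f\<close> multiplies the two minors in the Cauchy-Binet sum by the same sign, so each summand
  is a product of two minors with increasing indices.
\<close>

lemma minor_product_nonneg:
  assumes product: "\<And>i j. i < m \<Longrightarrow> j < m \<Longrightarrow> M (I i) (J j) = (\<Sum>l = 0..<N. A (I' i) l * B l (J' j))"
    and A: "\<And>s. strict_mono_on {..<m} s \<Longrightarrow> s ` {..<m} \<subseteq> {..<N} \<Longrightarrow> 0 \<le> minor A m I' s"
    and B: "\<And>s. strict_mono_on {..<m} s \<Longrightarrow> s ` {..<m} \<subseteq> {..<N} \<Longrightarrow> 0 \<le> minor B m s J'"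
  shows "0 \<le> minor M m I J"
proof -
  have "0 \<le> minor A m I' f * minor B m f J'" if f: "f \<in> {0..<m} \<rightarrow>\<^sub>E {0..<N}" for f
  proof (cases "inj_on f {0..<m}")
    case True
    obtain s p where s: "strict_mono_on {..<m} s" and img: "s ` {..<m} = f ` {0..<m}"
      and p: "p permutes {0..<m}" and fsp: "\<And>i. i < m \<Longrightarrow> f i = s (p i)"
      using sorting_permutation[OF True] by blast
    have sub: "s ` {..<m} \<subseteq> {..<N}"
      using img f by (auto simp: PiE_def Pi_def)
    have "minor B m f J' = signof p * minor B m s J'"
      using minor_permute_rows[OF p, of B s J'] minor_cong[of m B f J' B "\<lambda>i. s (p i)" J'] fsp
      by simp
    moreover have "minor A m I' f = signof p * minor A m I' s"
      using minor_permute_rows[OF p, of "\<lambda>i j. A j i" s I']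
        minor_cong[of m A I' f A I' "\<lambda>i. s (p i)"] fsp
      by (simp add: minor_transpose[of A])
    moreover have "signof p * signof p = (1 :: real)"
      by (simp add: sign_def)
    ultimately have "minor A m I' f * minor B m f J' = minor A m I' s * minor B m s J'"
      by (simp add: sign_def)
    then show ?thesis
      using A[OF s sub] B[OF s sub] by simp
  next
    case False
    then obtain i i' where "i < m" "i' < m" "i \<noteq> i'" "f i = f i'"
      by (auto simp: inj_on_def)
    then show ?thesis
      by (simp add: minor_equal_rows)
  qed
  then have "0 \<le> (\<Sum>f \<in> {0..<m} \<rightarrow>\<^sub>E {0..<N}. minor A m I' f * minor B m f J')"
    by (rule sum_nonneg)
  also have "\<dots> = fact m * minor M m I J"
    by (rule cauchy_binet_functions[symmetric]) (rule product)
  finally show ?thesis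
    using fact_gt_zero[of m, where 'a = real] by (simp add: zero_le_mult_iff)
qed

section \<open>From Toeplitz matrices to Riordan arrays\<close>

definition toeplitz :: "real poly \<Rightarrow> nat \<Rightarrow> nat \<Rightarrow> real" where
  "toeplitz g n l = (if l \<le> n then coeff g (n - l) else 0)"

text \<open>
  The bound \<open>N\<close> is free so that one finite sum serves all rows of a minor at once.
\<close>

lemma riordan_Suc_Suc:
  assumes "n < N"
  shows "coeff (pCons 0 g ^ Suc k) (Suc n) = (\<Sum>l = 0..<N. toeplitz g n l * coeff (pCons 0 g ^ k) l)"
proof -
  have "coeff (pCons 0 g ^ Suc k) (Suc n) = coeff (pCons 0 g ^ k * g) n"
    by (simp add: mult.commute)
  also have "\<dots> = (\<Sum>l\<le>n. toeplitz g n l * coeff (pCons 0 g ^ k) l)"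
    unfolding coeff_mult by (intro sum.cong) (auto simp: toeplitz_def)
  also have "\<dots> = (\<Sum>l = 0..<N. toeplitz g n l * coeff (pCons 0 g ^ k) l)"
    using assms by (intro sum.mono_neutral_left) (auto simp: toeplitz_def)
  finally show ?thesis .
qed

lemma riordan_border:
  "coeff (pCons (0 :: real) g ^ k) 0 = (if k = 0 then 1 else 0)"
  "coeff (pCons (0 :: real) g ^ 0) n = (if n = 0 then 1 else 0)"
  by (cases k; simp) (simp add: coeff_1)

text \<open>
  The array with entries \<open>[t\<^sup>n] (t g)\<^sup>k\<close> is the Riordan array \<open>(1, t g)\<close>. A minor of it that
  avoids the first row and the first column is a minor of the product of the Toeplitz matrix with
  the same array cut off at a smaller row bound; the first row and the first column are unit vectors, so
  a minor that meets them is 0 or loses them by expansion.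
\<close>

theorem TP_upto_riordan:
  fixes g :: "real poly"
  assumes TP: "TP_upto r (toeplitz g)"
  shows "TP_upto r (\<lambda>n k. coeff (pCons 0 g ^ k) n)"
proof -
  let ?R = "\<lambda>n k. coeff (pCons 0 g ^ k) n"
  have "0 \<le> minor ?R m I J"
    if "m \<le> r" "strict_mono_on {..<m} I" "strict_mono_on {..<m} J" "I ` {..<m} \<subseteq> {..<N}"
    for N m I J
    using that
  proof (induction N arbitrary: m I J)
    case 0
    then have "m = 0" by auto
    then show ?case by simp
  next
    case (Suc N)
    have positive: "0 \<le> minor ?R m I J"
      if "m \<le> r" "strict_mono_on {..<m} I" "strict_mono_on {..<m} J" "I ` {..<m} \<subseteq> {..<Suc N}"
        and pos: "\<And>i. i < m \<Longrightarrow> 0 < I i" "\<And>j. j < m \<Longrightarrow> 0 < J j"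
      for m I J
    proof (cases "m = 0")
      case False
      have I: "strict_mono_on {..<m} (\<lambda>i. I i - 1)" and J: "strict_mono_on {..<m} (\<lambda>j. J j - 1)"
        using that(2,3) pos unfolding strict_mono_on_def by (auto simp: diff_less_mono Suc_leI)
      show ?thesis
      proof (rule minor_product_nonneg)
        fix i j assume "i < m" "j < m"
        moreover from this have "I i - 1 < N"
          using that(4) pos(1)[of i] by (auto simp: subset_iff image_iff)
        ultimately show "coeff (pCons 0 g ^ J j) (I i)
            = (\<Sum>l = 0..<N. toeplitz g (I i - 1) l * coeff (pCons 0 g ^ (J j - 1)) l)"
          using riordan_Suc_Suc[of "I i - 1" N g "J j - 1"] pos(1)[of i] pos(2)[of j] by simp
      next
        fix s :: "nat \<Rightarrow> nat" assume "strict_mono_on {..<m} s"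
        then show "0 \<le> minor (toeplitz g) m (\<lambda>i. I i - 1) s"
          using TP I False \<open>m \<le> r\<close> unfolding TP_upto_def by (simp add: Suc_leI)
      next
        fix s :: "nat \<Rightarrow> nat" assume "strict_mono_on {..<m} s" "s ` {..<m} \<subseteq> {..<N}"
        then show "0 \<le> minor ?R m s (\<lambda>j. J j - 1)"
          using Suc.IH \<open>m \<le> r\<close> J by blast
      qed
    qed simp
    show ?case
    proof (cases m)
      case 0
      then show ?thesis by simp
    next
      case (Suc m')
      have I_pos: "0 < I i" if "0 < i \<or> 0 < I 0" "i < m" for i
        using strict_mono_onD[OF Suc.prems(2), of 0 i] that by (cases "i = 0") auto
      have J_pos: "0 < J i" if "0 < i \<or> 0 < J 0" "i < m" for i
        using strict_mono_onD[OF Suc.prems(3), of 0 i] that by (cases "i = 0") auto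
      consider (inner) "0 < I 0" "0 < J 0" | (corner) "I 0 = 0" "J 0 = 0"
        | (row) "I 0 = 0" "0 < J 0" | (column) "0 < I 0" "J 0 = 0"
        by auto
      then show ?thesis
      proof cases
        case inner
        then show ?thesis
          using positive[OF Suc.prems] I_pos J_pos by blast
      next
        case corner
        show ?thesis
        proof (rule minor_split_nonneg[of 1])
          show "1 \<le> m" using Suc by simp
          show "(\<forall>i j. i < 1 \<longrightarrow> 1 \<le> j \<longrightarrow> j < m \<longrightarrow> ?R (I i) (J j) = 0)
              \<or> (\<forall>i j. 1 \<le> i \<longrightarrow> i < m \<longrightarrow> j < 1 \<longrightarrow> ?R (I i) (J j) = 0)"
            using corner J_pos by (force simp: riordan_border)
          show "0 \<le> minor ?R 1 I J"
            using corner by simp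
          have "I i < Suc N" if "i < m" for i
            using Suc.prems(4) that by blast
          then have "(\<lambda>i. I (i + 1)) ` {..<m - 1} \<subseteq> {..<Suc N}"
            by auto
          then show "0 \<le> minor ?R (m - 1) (\<lambda>i. I (i + 1)) (\<lambda>j. J (j + 1))"
            using Suc.prems(1-3) I_pos J_pos
            by (intro positive strict_mono_on_lessThan_shift) auto
        qed
      next
        case row
        then have "?R (I 0) (J j) = 0" if "j < m" for j
          using J_pos[of j] that by (simp add: riordan_border)
        then show ?thesis
          using \<open>m = Suc m'\<close> by (simp add: minor_first_row)
      next
        case column
        then have "?R (I i) (J 0) = 0" if "i < m" for i
          using I_pos[of i] that by (simp add: riordan_border)
        then have "minor (\<lambda>k n. ?R n k) m J I = 0"
          using \<open>m = Suc m'\<close> by (simp add: minor_first_row)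
        then show ?thesis
          by (simp add: minor_transpose[of ?R])
      qed
    qed
  qed
  then show ?thesis
    unfolding TP_upto_def by (metis (no_types, lifting) finite_imageI finite_lessThan finite_nat_iff_bounded)
qed

section \<open>The Toeplitz matrix of a quadratic polynomial\<close>

lemma toeplitz_quadratic:
  "toeplitz [:a, b, c:] n l
    = (if n = l then a else if n = Suc l then b else if n = Suc (Suc l) then c else 0)"
  by (auto simp: toeplitz_def coeff_pCons split: nat.split)

text \<open>
  Shifting the rows by one puts \<open>b\<close> on the diagonal, so this is the determinant of the \<open>m\<close> by
  \<open>m\<close> tridiagonal Toeplitz matrix with \<open>a\<close> above and \<open>c\<close> below the diagonal.
\<close>

definition continuant :: "real \<Rightarrow> real \<Rightarrow> real \<Rightarrow> nat \<Rightarrow> real" where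
  "continuant a b c m = minor (toeplitz [:a, b, c:]) m Suc (\<lambda>j. j)"

lemma continuant_0 [simp]: "continuant a b c 0 = 1"
  by (simp add: continuant_def)

lemma continuant_1 [simp]: "continuant a b c (Suc 0) = b"
  by (simp add: continuant_def toeplitz_quadratic)

lemma continuant_Suc_Suc:
  "continuant a b c (Suc (Suc m)) = b * continuant a b c (Suc m) - a * c * continuant a b c m"
proof -
  let ?T = "toeplitz [:a, b, c:]"
  let ?skip = "\<lambda>k. if k < Suc 0 then k else Suc k"
  have "minor ?T (Suc m) (\<lambda>i. Suc (Suc i)) ?skip
      = minor ?T 1 (\<lambda>i. Suc (Suc i)) ?skip
        * minor ?T (Suc m - 1) (\<lambda>i. Suc (Suc (i + 1))) (\<lambda>j. ?skip (j + 1))"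
    by (rule minor_block_upper) (auto simp: toeplitz_quadratic)
  also have "\<dots> = c * continuant a b c m"
    unfolding continuant_def
    by (auto intro!: arg_cong2[where f = "(*)"] minor_cong simp: toeplitz_quadratic)
  finally have second: "minor ?T (Suc m) (\<lambda>i. Suc (Suc i)) ?skip = c * continuant a b c m" .
  have first: "minor ?T (Suc m) (\<lambda>i. Suc (Suc i)) Suc = continuant a b c (Suc m)"
    unfolding continuant_def by (rule minor_cong) (simp add: toeplitz_quadratic)
  have "continuant a b c (Suc (Suc m)) = (\<Sum>j<Suc (Suc m). (-1) ^ j * ?T 1 j *
      minor ?T (Suc m) (\<lambda>i. Suc (Suc i)) (\<lambda>k. if k < j then k else Suc k))"
    by (simp only: continuant_def minor_first_row[of _ "Suc m"] One_nat_def)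
  then show ?thesis
    unfolding sum.lessThan_Suc_shift using first second by (simp add: toeplitz_quadratic)
qed

text \<open>
  The ratio \<open>sin ((m + 2) \<theta>) / sin ((m + 1) \<theta>)\<close> times \<open>\<surd>(a c)\<close> is the ratio of consecutive
  continuants in the extremal case \<open>b = 2 \<surd>(a c) cos \<theta>\<close>. Since the recurrence makes
  \<open>D\<^sub>m\<^sub>+\<^sub>2 / D\<^sub>m\<^sub>+\<^sub>1\<close> increase with \<open>b\<close> and with \<open>D\<^sub>m\<^sub>+\<^sub>1 / D\<^sub>m\<close>, it is a lower bound in
  general. Comparing ratios, rather than solving the recurrence, covers \<open>a c = 0\<close> and
  \<open>b > 2 \<surd>(a c)\<close> without case distinctions; the inequality is stated without denominators.
\<close>

lemma continuant_nonneg: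
  assumes "0 \<le> a" "0 \<le> b" "0 \<le> c" "1 \<le> r"
    and disc: "4 * a * c * (cos (pi / (real r + 1)))\<^sup>2 \<le> b\<^sup>2"
    and "m \<le> r"
  shows "0 \<le> continuant a b c m"
proof -
  define \<theta> q D S where "\<theta> = pi / (real r + 1)" and "q = sqrt (a * c)"
    and "D = continuant a b c" and "S k = sin (real k * \<theta>)" for k :: nat
  have q: "0 \<le> q" "q * q = a * c"
    using assms by (simp_all add: q_def)
  have \<theta>: "0 < \<theta>" "\<theta> \<le> pi / 2" "real (Suc r) * \<theta> = pi"
    using \<open>1 \<le> r\<close> by (auto simp: \<theta>_def field_simps)
  have S_nonneg: "0 \<le> S k" if "k \<le> Suc r" for k
  proof -
    have "real k * \<theta> \<le> real (Suc r) * \<theta>"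
      using that \<theta> by (intro mult_right_mono) auto
    also note \<theta>(3)
    finally show ?thesis
      using \<theta> unfolding S_def by (intro sin_ge_zero) auto
  qed
  have S_pos: "0 < S k" if "0 < k" "k \<le> r" for k
  proof -
    have "real k * \<theta> < real (Suc r) * \<theta>"
      using that \<theta> by (intro mult_strict_right_mono) auto
    also note \<theta>(3)
    finally show ?thesis
      using \<theta>(1) that unfolding S_def by (intro sin_gt_zero) auto
  qed
  have S_rec: "2 * cos \<theta> * S (Suc k) = S (Suc (Suc k)) + S k" for k
  proof -
    have "S (Suc (Suc k)) = sin (real (Suc k) * \<theta> + \<theta>)" "S k = sin (real (Suc k) * \<theta> - \<theta>)"
      by (simp_all add: S_def algebra_simps)
    then show ?thesis
      by (simp add: S_def sin_add sin_diff)
  qed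
  have b: "2 * q * cos \<theta> \<le> b"
  proof (rule power2_le_imp_le)
    have "(2 * q * cos \<theta>)\<^sup>2 = 4 * (q * q) * (cos \<theta>)\<^sup>2"
      by (simp add: power2_eq_square)
    then show "(2 * q * cos \<theta>)\<^sup>2 \<le> b\<^sup>2"
      using disc by (simp add: q(2) \<theta>_def)
  qed fact
  have "0 \<le> D m \<and> 0 \<le> D (Suc m) \<and> q * S (Suc (Suc m)) * D m \<le> S (Suc m) * D (Suc m)"
    if "Suc m \<le> r" for m
    using that
  proof (induction m)
    case 0
    have "S 0 = 0" by (simp add: S_def)
    then have "q * S 2 = (2 * q * cos \<theta>) * S 1"
      using S_rec[of 0] by (simp add: numeral_2_eq_2)
    also have "\<dots> \<le> b * S 1"
      using b S_nonneg[of 1] by (intro mult_right_mono) auto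
    finally show ?case
      using assms by (simp add: D_def numeral_2_eq_2 mult.commute)
  next
    case (Suc m)
    then have IH: "0 \<le> D m" "0 \<le> D (Suc m)" "q * S (Suc (Suc m)) * D m \<le> S (Suc m) * D (Suc m)"
      by auto
    let ?s = "S (Suc (Suc m))"
    have s: "0 < ?s" using S_pos[of "Suc (Suc m)"] Suc.prems by simp
    have "q * S (Suc (Suc (Suc m))) * D (Suc m) = 2 * q * cos \<theta> * (?s * D (Suc m)) - q * (S (Suc m) * D (Suc m))"
      using S_rec[of "Suc m"] by (simp add: algebra_simps)
    also have "\<dots> \<le> b * (?s * D (Suc m)) - q * (q * ?s * D m)"
      using b s IH q(1) by (intro diff_mono mult_right_mono mult_left_mono) auto
    also have "\<dots> = ?s * (b * D (Suc m) - (q * q) * D m)"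
      by (simp add: algebra_simps)
    also have "\<dots> = ?s * D (Suc (Suc m))"
      by (simp add: D_def continuant_Suc_Suc q(2))
    finally have step: "q * S (Suc (Suc (Suc m))) * D (Suc m) \<le> ?s * D (Suc (Suc m))" .
    moreover have "0 \<le> q * S (Suc (Suc (Suc m))) * D (Suc m)"
      using q(1) IH S_nonneg[of "Suc (Suc (Suc m))"] Suc.prems by simp
    ultimately have "0 \<le> D (Suc (Suc m))"
      using s by (meson order_trans zero_le_mult_iff not_less)
    then show ?case
      using IH step by simp
  qed
  then show ?thesis
    using \<open>m \<le> r\<close> by (cases m) (auto simp: D_def)
qed

text \<open>
  After the shift of the rows, the entry in row \<open>I i\<close> and column \<open>J j\<close> can be nonzero only if
  \<open>I i\<close> and \<open>Suc (J j)\<close> differ by at most 1. As both index sequences increase, a deviation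
  \<open>I l \<noteq> Suc (J l)\<close> or a gap in the indices therefore forces a zero block, and the minor splits
  into smaller ones. What cannot be split is a single entry or a continuant.
\<close>

theorem TP_upto_toeplitz_quadratic:
  assumes coeffs: "0 \<le> a" "0 \<le> b" "0 \<le> c" and "1 \<le> r"
    and disc: "4 * a * c * (cos (pi / (real r + 1)))\<^sup>2 \<le> b\<^sup>2"
  shows "TP_upto r (toeplitz [:a, b, c:])"
proof -
  let ?T = "toeplitz [:a, b, c:]"
  have "0 \<le> minor ?T m I J"
    if "m \<le> r" "strict_mono_on {..<m} I" "strict_mono_on {..<m} J" for m I J
    using that
  proof (induction m arbitrary: I J rule: less_induct)
    case (less m)
    have I: "I i < I i'" and J: "J i < J i'" if "i < i'" "i' < m" for i i'
      using less.prems(2,3) that by (auto simp: strict_mono_on_def)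
    have I_le: "I i \<le> I i'" and J_le: "J i \<le> J i'" if "i \<le> i'" "i' < m" for i i'
      using I[of i i'] J[of i i'] that by (auto simp: le_less)
    have split: "0 \<le> minor ?T m I J"
      if "0 < l" "l < m" "(\<forall>i j. i < l \<longrightarrow> l \<le> j \<longrightarrow> j < m \<longrightarrow> ?T (I i) (J j) = 0)
       \<or> (\<forall>i j. l \<le> i \<longrightarrow> i < m \<longrightarrow> j < l \<longrightarrow> ?T (I i) (J j) = 0)" for l
    proof (rule minor_split_nonneg[of l])
      show "0 \<le> minor ?T l I J"
        using less.prems that(2)
        by (intro less.IH) (auto intro: strict_mono_on_lessThan_prefix[of m])
      show "0 \<le> minor ?T (m - l) (\<lambda>i. I (i + l)) (\<lambda>j. J (j + l))"
        using less.prems that(1,2)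
        by (intro less.IH strict_mono_on_lessThan_shift) auto
    qed (use that in auto)
    consider (small) "m \<le> 1" | (off) l where "1 < m" "l < m" "I l \<noteq> Suc (J l)"
      | (gap) l where "\<forall>i<m. I i = Suc (J i)" "Suc l < m" "J (Suc l) \<noteq> Suc (J l)"
      | (contiguous) "\<forall>i<m. I i = Suc (J i)" "\<forall>l. Suc l < m \<longrightarrow> J (Suc l) = Suc (J l)"
      using not_le by blast
    then show ?case
    proof cases
      case small
      then have "m = 0 \<or> m = Suc 0" by auto
      then show ?thesis
        using coeffs by (auto simp: toeplitz_quadratic)
    next
      case off
      \<comment> \<open>Cutting just before or just after \<open>l\<close> both yield a zero block; the cut only has to be
        proper, which for \<open>l = 0\<close> excludes the first choice.\<close>
      define s where "s = (if l = 0 then 1 else l)"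
      have s: "0 < s" "s < m" "s = l \<or> s = Suc l"
        using off by (auto simp: s_def)
      show ?thesis
      proof (cases "I l \<le> J l")
        case True
        have "I i < J j" if "i < s" "s \<le> j" "j < m" for i j
        proof (cases "i = l")
          case True
          then show ?thesis using \<open>I l \<le> J l\<close> J[of l j] that s by auto
        next
          case False
          then show ?thesis using \<open>I l \<le> J l\<close> I[of i l] J_le[of l j] that s off by auto
        qed
        then show ?thesis
          using s by (intro split[of s]) (fastforce simp: toeplitz_quadratic)+
      next
        case False
        then have l: "Suc (Suc (J l)) \<le> I l" using off by auto
        have "Suc (Suc (J j)) < I i" if "j < s" "s \<le> i" "i < m" for i j
        proof (cases "j = l")
          case True
          then show ?thesis using l I[of l i] that s by auto
        next
          case False
          then show ?thesis using l J[of j l] I_le[of l i] that s off by auto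
        qed
        then show ?thesis
          using s by (intro split[of s]) (fastforce simp: toeplitz_quadratic)+
      qed
    next
      case gap
      have "I i < J j" if "i < Suc l" "Suc l \<le> j" "j < m" for i j
        using gap J_le[of i l] J[of l "Suc l"] J_le[of "Suc l" j] that by auto
      then show ?thesis
        using gap(2) by (intro split[of "Suc l"]) (fastforce simp: toeplitz_quadratic)+
    next
      case contiguous
      have J_eq: "J i = J 0 + i" if "i < m" for i
        using that by (induction i) (auto simp: contiguous(2))
      have "minor ?T m I J = continuant a b c m"
        unfolding continuant_def
      proof (rule minor_cong)
        fix i j assume "i < m" "j < m"
        then have "I i = J 0 + Suc i" "J j = J 0 + j"
          using contiguous(1) J_eq[of i] J_eq[of j] by auto
        then show "?T (I i) (J j) = ?T (Suc i) j"
          by (simp add: toeplitz_quadratic)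
      qed
      then show ?thesis
        using continuant_nonneg[OF assms] less.prems by simp
    qed
  qed
  then show ?thesis
    unfolding TP_upto_def by blast
qed

section \<open>Coefficients of powers of the cubic\<close>

lemma coeff_pCons_zero_power:
  "coeff (pCons 0 g ^ k) n = (if k \<le> n then coeff (g ^ k) (n - k) else 0)"
  for g :: "'a :: comm_semiring_1 poly"
proof -
  have "pCons 0 g = monom 1 1 * g"
    by (simp add: monom_altdef)
  then have "pCons 0 g ^ k = monom 1 k * g ^ k"
    by (simp add: power_mult_distrib monom_power)
  then show ?thesis
    by (simp add: coeff_monom_mult)
qed

lemma coeff_linear_poly_power_if:
  "coeff ([:b, c:] ^ i) d = (if d \<le> i then of_nat (i choose d) * c ^ d * b ^ (i - d) else 0)"
  for b c :: "'a :: comm_semiring_1"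
proof (cases "d \<le> i")
  case False
  have "degree ([:b, c:] ^ i) \<le> degree [:b, c:] * i"
    by (rule degree_power_le)
  also have "\<dots> \<le> i"
    by simp
  finally show ?thesis
    using False by (simp add: coeff_eq_0)
qed (simp add: coeff_linear_poly_power)

lemma coeff_quadratic_power:
  "coeff ([:a, b, c:] ^ k) n = (\<Sum>i\<le>k. of_nat (k choose i) * a ^ (k - i)
      * (if i \<le> n \<and> n - i \<le> i then of_nat (i choose (n - i)) * c ^ (n - i) * b ^ (2 * i - n) else 0))"
  for a b c :: "'a :: comm_semiring_1"
proof -
  have "[:a, b, c:] = pCons 0 [:b, c:] + [:a:]"
    by simp
  then have "[:a, b, c:] ^ k = (\<Sum>i\<le>k. of_nat (k choose i) * pCons 0 [:b, c:] ^ i * [:a:] ^ (k - i))"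
    by (simp only: binomial_ring)
  also have "\<dots> = (\<Sum>i\<le>k. smult (of_nat (k choose i) * a ^ (k - i)) (pCons 0 [:b, c:] ^ i))"
    by (intro sum.cong refl) (simp add: poly_const_pow of_nat_poly mult_ac)
  finally show ?thesis
    by (auto simp: coeff_sum coeff_pCons_zero_power coeff_linear_poly_power_if mult_2 intro!: sum.cong)
qed

text \<open>
  Comparing coefficients in \<open>(f\<^sup>k\<^sup>+\<^sup>1)' = (k + 1) f\<^sup>k f'\<close>. For \<open>n < 2\<close> the truncated row indices are
  harmless because their factors vanish.
\<close>

lemma exponential_riordan_recurrence:
  fixes a b c :: real
  defines "R \<equiv> \<lambda>n k. fact n / fact k * coeff ([:0, a, b, c:] ^ k) n"
  shows "R (Suc n) (Suc k) = a * R n k + 2 * b * real n * R (n - 1) k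
           + 3 * c * real n * (real n - 1) * R (n - 2) k"
proof -
  let ?f = "[:0, a, b, c:]"
  have "real (Suc n) * coeff (?f ^ Suc k) (Suc n) = coeff (pderiv (?f ^ Suc k)) n"
    by (simp only: coeff_pderiv)
  also have "\<dots> = real (Suc k) * coeff ([:a, 2 * b, 3 * c:] * ?f ^ k) n"
    unfolding pderiv_power_Suc by (simp add: pderiv_pCons mult.commute)
  finally have deriv: "real (Suc n) * coeff (?f ^ Suc k) (Suc n)
      = real (Suc k) * coeff ([:a, 2 * b, 3 * c:] * ?f ^ k) n" .
  have "R (Suc n) (Suc k) = fact n / fact (Suc k) * (real (Suc n) * coeff (?f ^ Suc k) (Suc n))"
    by (simp add: R_def)
  also have "\<dots> = fact n / fact k * coeff ([:a, 2 * b, 3 * c:] * ?f ^ k) n"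
    unfolding deriv by (simp add: fact_Suc del: of_nat_Suc mult_pCons_left)
  finally have main: "R (Suc n) (Suc k) = fact n / fact k * coeff ([:a, 2 * b, 3 * c:] * ?f ^ k) n" .
  consider "n = 0" | "n = 1" | n' where "n = Suc (Suc n')"
    by (metis One_nat_def not0_implies_Suc)
  then show ?thesis
    unfolding main by cases (simp_all add: R_def field_simps)
qed

section \<open>The array of the cubic\<close>

theorem proposition4p2:
  fixes a b c :: real and B :: "int \<Rightarrow> nat \<Rightarrow> real"
  assumes "a \<ge> 0" and "b \<ge> 0" and "c \<ge> 0"
    and recurrence: "\<And>n k. n \<ge> 1 \<Longrightarrow> k \<ge> 1 \<Longrightarrow>
      B n k = a * B (n - 1) (k - 1)
            + 2 * b * of_int (n - 1) * B (n - 2) (k - 1)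
            + 3 * c * of_int (n - 1) * of_int (n - 2) * B (n - 3) (k - 1)"
    and row_zero: "\<And>k. B 0 k = (if k = 0 then 1 else 0)"
    and column_zero: "\<And>n. n \<ge> 1 \<Longrightarrow> B n 0 = 0"
    and negative_rows: "\<And>n k. n < 0 \<Longrightarrow> B n k = 0"
  shows "(\<forall>n k :: nat. n \<ge> 1 \<and> k \<ge> 1 \<longrightarrow>
      B (int n) k = fact n / fact k *
        (\<Sum>i = 0..k. a ^ (k - i)
           * c powi (int n - int k - int i)
           * b powi (2 * int i - int n + int k)
           * real (k choose i)
           * real (binomial_int i (int n - int k - int i))))
    \<and> (\<forall>r :: nat. r \<ge> 1 \<longrightarrow> b\<^sup>2 \<ge> 4 * a * c * (cos (pi / (real r + 1)))\<^sup>2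
         \<longrightarrow> TP_upto r (\<lambda>n k. B (int n) k))
    \<and> (b\<^sup>2 \<ge> 4 * a * c \<longrightarrow> TP (\<lambda>n k. B (int n) k))"
proof -
  let ?f = "[:0, a, b, c:]"
  have B_eq: "B (int n) k = fact n / fact k * coeff (?f ^ k) n" for n k
  proof (induction k arbitrary: n)
    case 0
    then show ?case
      using row_zero[of 0] column_zero[of "int n"] by (cases n) (auto simp: coeff_1)
  next
    case (Suc k)
    show ?case
    proof (cases n)
      case 0
      then show ?thesis
        using row_zero[of "Suc k"] by simp
    next
      case (Suc n')
      have second: "real n' * B (int n' - 1) k
          = real n' * (fact (n' - 1) / fact k * coeff (?f ^ k) (n' - 1))"
        using Suc.IH[of "n' - 1"] by (cases n') auto
      have third: "real n' * (real n' - 1) * B (int n' - 2) k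
          = real n' * (real n' - 1) * (fact (n' - 2) / fact k * coeff (?f ^ k) (n' - 2))"
      proof -
        consider "n' = 0" | "n' = 1" | "int n' - 2 = int (n' - 2)"
          by linarith
        then show ?thesis
        proof cases
          case 3
          then show ?thesis
            using Suc.IH[of "n' - 2"] by (simp only:)
        qed simp_all
      qed
      have "B (int n) (Suc k) = a * B (int n') k + 2 * b * (real n' * B (int n' - 1) k)
          + 3 * c * (real n' * (real n' - 1) * B (int n' - 2) k)"
        using recurrence[of "int n" "Suc k"] Suc by (simp add: mult_ac)
      also have "\<dots> = fact n / fact (Suc k) * coeff (?f ^ Suc k) n"
        unfolding second third Suc.IH \<open>n = Suc n'\<close> exponential_riordan_recurrence by (simp only: mult_ac)
      finally show ?thesis .
    qed
  qed
  have formula: "B (int n) k = fact n / fact k *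
        (\<Sum>i = 0..k. a ^ (k - i)
           * c powi (int n - int k - int i)
           * b powi (2 * int i - int n + int k)
           * real (k choose i)
           * real (binomial_int i (int n - int k - int i)))" for n k
  proof -
    have "a ^ (k - i) * c powi (int n - int k - int i) * b powi (2 * int i - int n + int k)
          * real (k choose i) * real (binomial_int i (int n - int k - int i))
        = (if k \<le> n then real (k choose i) * a ^ (k - i)
            * (if i \<le> n - k \<and> n - k - i \<le> i
               then real (i choose (n - k - i)) * c ^ (n - k - i) * b ^ (2 * i - (n - k)) else 0)
           else 0)" (is "?lhs = ?rhs") for i
    proof (cases "k \<le> n \<and> i \<le> n - k \<and> n - k - i \<le> i")
      case True
      then have "int n - int k - int i = int (n - k - i)"
        and "2 * int i - int n + int k = int (2 * i - (n - k))"
        by auto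
      note exponents = this
      show ?thesis
        unfolding exponents power_int_of_nat binomial_int_def using True by (simp add: mult_ac)
    next
      case False
      then have "binomial_int i (int n - int k - int i) = 0"
        by (auto simp: binomial_int_def intro!: binomial_eq_0)
      then show ?thesis
        using False by auto
    qed
    then show ?thesis
      by (simp add: B_eq coeff_pCons_zero_power coeff_quadratic_power atMost_atLeast0)
  qed
  have TP_r: "TP_upto r (\<lambda>n k. B (int n) k)"
    if "1 \<le> r" and disc: "4 * a * c * (cos (pi / (real r + 1)))\<^sup>2 \<le> b\<^sup>2" for r
  proof -
    have "TP_upto r (\<lambda>n k. coeff (?f ^ k) n)"
      using assms(1-3) that by (intro TP_upto_riordan TP_upto_toeplitz_quadratic)
    moreover have "minor (\<lambda>n k. B (int n) k) m I J
        = (\<Prod>i<m. fact (I i)) * (\<Prod>j<m. 1 / fact (J j)) * minor (\<lambda>n k. coeff (?f ^ k) n) m I J"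
      for m I J
      by (simp add: B_eq minor_scale[of fact "\<lambda>k. 1 / fact k", symmetric])
    ultimately show ?thesis
      unfolding TP_upto_def by (simp add: prod_nonneg)
  qed
  have "TP (\<lambda>n k. B (int n) k)" if disc: "4 * a * c \<le> b\<^sup>2"
  proof -
    have "TP_upto r (\<lambda>n k. B (int n) k)" if "1 \<le> r" for r
    proof (rule TP_r[OF that])
      have "4 * a * c * (cos (pi / (real r + 1)))\<^sup>2 \<le> 4 * a * c * 1"
        using assms(1,3) by (intro mult_left_mono) (auto simp: abs_square_le_1)
      then show "4 * a * c * (cos (pi / (real r + 1)))\<^sup>2 \<le> b\<^sup>2"
        using disc by simp
    qed
    then show ?thesis
      unfolding TP_def TP_upto_def by blast
  qed
  with formula TP_r show ?thesis
    by blast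
qed

end
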